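(* Let $h$ be the unique root in the interval $(0,1)$ of $x^6-3 x^5+5 x^4-8 x^3+5 x^2-3 x+1 = 0$. Then $$ \operatorname{Li}_2\left(h^8\right) + 3 \operatorname{Li}_2\left(h^6\right) - 8 \operatorname{Li}_2\left(h^4\right) - 8 \operatorname{Li}_2\left(h^3\right) + 3 \operatorname{Li}_2\left(h^2\right) - 8 \operatorname{Li}_2(h)-6 \ln ^2(h) = -5 \zeta(2). $$
   Context: $\operatorname{Li}_2(x)=\sum_{n\ge1}x^n/n^2$ for $|x|\le1$; $\zeta(2)=\pi^2/6$. *)

theory Defs
  imports "HOL-Analysis.Analysis"
begin

text \<open>The series starts at exponent 1, hence the shift by \<open>Suc\<close>. It converges
  exactly for \<open>\<bar>x\<bar> \<le> 1\<close>; outside this range the value is unspecified.\<close>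

definition Li2 :: "real \<Rightarrow> real" where
  "Li2 x = (\<Sum>n. x ^ Suc n / real (Suc n) ^ 2)"

text \<open>Values at natural numbers \<open>s \<ge> 2\<close> only.\<close>

definition zeta :: "nat \<Rightarrow> real" where
  "zeta s = (\<Sum>n. 1 / real (Suc n) ^ s)"

lemma zeta_2: "zeta 2 = pi\<^sup>2 / 6"
  using inverse_squares_sums by (simp add: zeta_def sums_iff add.commute)

lemma Li2_sums:
  assumes "\<bar>x\<bar> \<le> 1"
  shows "(\<lambda>n. x ^ Suc n / real (Suc n) ^ 2) sums Li2 x"
proof -
  have "summable (\<lambda>n. 1 / real (Suc n) ^ 2)"
    using inverse_squares_sums by (simp add: sums_iff add.commute)
  moreover have "norm (x ^ Suc n / real (Suc n) ^ 2) \<le> 1 / real (Suc n) ^ 2" for n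
  proof -
    have "\<bar>x\<bar> ^ Suc n \<le> 1"
      using assms by (intro power_le_one) auto
    then show ?thesis
      unfolding real_norm_def abs_divide power_abs
      by (intro frac_le) auto
  qed
  ultimately have "summable (\<lambda>n. x ^ Suc n / real (Suc n) ^ 2)"
    by (rule summable_comparison_test'[where N = 0])
  then show ?thesis
    unfolding Li2_def by (rule summable_sums)
qed

end

theory Submission
  imports Defs "HOL-Real_Asymp.Real_Asymp"
begin

text \<open>The Rogers dilogarithm \<open>Li2 x + ln x * ln (1 - x) / 2\<close> satisfies, without elementary
  correction terms, a reflection formula and Abel's five-term relation on the unit interval; both
  follow by differentiation and a limit at 0. In terms of it the logarithms in the ladder cancel,
  because the numbers \<open>1 - h ^ k\<close> satisfy a multiplicative relation modulo powers of \<open>h\<close>.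
  What remains is a rational linear relation between values of the Rogers dilogarithm at powers
  of \<open>h\<close>. It is an explicit combination of five-term relations, all of whose arguments \<open>x\<close> are
  exceptional: both \<open>x\<close> and \<open>1 - x\<close> are monomials in \<open>h\<close>, \<open>1 - h\<close>, \<open>1 + h\<close>, \<open>1 + h\<^sup>2\<close>,
  \<open>1 - h + h\<^sup>2\<close> and \<open>1 - 2 h\<close>, the last of which is a unit of the ring of integers of the field
  generated by \<open>h\<close>. The combination was found by a computer search over such arguments.\<close>

subsection \<open>The Rogers dilogarithm\<close>

text \<open>The bound 1/n^2 is summable up to the endpoints, so the value at 1 is also a one-sided
  limit, where the power series cannot be differentiated termwise.\<close>

lemma continuous_on_Li2: "continuous_on {-1..1} Li2"
proof (rule uniform_limit_theorem)
  show "uniform_limit {-1..1} (\<lambda>n x. \<Sum>i<n. x ^ Suc i / real (Suc i) ^ 2) Li2 sequentially"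
    unfolding Li2_def
  proof (rule Weierstrass_m_test)
    show "norm (x ^ Suc n / real (Suc n) ^ 2) \<le> 1 / real (Suc n) ^ 2"
      if "x \<in> {-1..1}" for n and x :: real
    proof -
      have "\<bar>x\<bar> ^ Suc n \<le> 1"
        using that by (intro power_le_one) auto
      then show ?thesis
        unfolding real_norm_def abs_divide power_abs
        by (intro frac_le) auto
    qed
    show "summable (\<lambda>n. 1 / real (Suc n) ^ 2)"
      using inverse_squares_sums by (simp add: sums_iff add.commute)
  qed
qed (auto intro!: always_eventually continuous_intros)

lemma Li2_0 [simp]: "Li2 0 = 0"
  by (simp add: Li2_def)

lemma Li2_1: "Li2 1 = zeta 2"
  by (simp add: Li2_def zeta_def)

lemma DERIV_Li2:
  assumes "0 < x" "x < 1"
  shows "(Li2 has_real_derivative - ln (1 - x) / x) (at x)"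
proof -
  \<comment> \<open>Unshifted coefficients suit termwise differentiation. \<open>c 0\<close> is 0
    because division by zero yields 0, so the additional constant term vanishes.\<close>
  define c :: "nat \<Rightarrow> real" where "c n = 1 / real n ^ 2" for n
  have sums: "(\<lambda>n. c n * t ^ n) sums Li2 t" if "\<bar>t\<bar> \<le> 1" for t
  proof -
    have "(\<lambda>n. c (Suc n) * t ^ Suc n) sums Li2 t"
      using Li2_sums[OF that] by (simp add: c_def)
    then show ?thesis
      using sums_Suc_iff[of "\<lambda>n. c n * t ^ n" "Li2 t"] by (simp add: c_def)
  qed
  have "summable (\<lambda>n. c n * 1 ^ n)"
    using inverse_squares_sums summable_Suc_iff[of "\<lambda>n. 1 / real n ^ 2"]
    by (simp add: sums_iff add.commute c_def)
  then have "DERIV (\<lambda>x. \<Sum>n. c n * x ^ n) x :> (\<Sum>n. diffs c n * x ^ n)"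
    by (rule termdiffs_strong) (use assms in auto)
  moreover have "(\<Sum>n. diffs c n * x ^ n) = - ln (1 - x) / x"
  proof -
    have "- ln (1 - x) = - (\<Sum>n. (-1) ^ n * (1 / real (n + 1)) * (1 - x - 1) ^ Suc n)"
      using assms by (subst ln_series) auto
    also have "(\<lambda>n. (-1) ^ n * (1 / real (n + 1)) * (1 - x - 1) ^ Suc n)
        = (\<lambda>n. - (x * (diffs c n * x ^ n)))"
    proof
      fix n
      have "(-1) ^ n * (- x) ^ n = x ^ n"
        by (simp flip: power_mult_distrib)
      then have "(-1) ^ n * (- x) ^ Suc n = - x * x ^ n"
        by simp
      then show "(-1) ^ n * (1 / real (n + 1)) * (1 - x - 1) ^ Suc n
          = - (x * (diffs c n * x ^ n))"
        by (simp add: diffs_def c_def power2_eq_square)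
    qed
    also have "- (\<Sum>n. - (x * (diffs c n * x ^ n))) = x * (\<Sum>n. diffs c n * x ^ n)"
    proof -
      have "summable (\<lambda>n. diffs c n * x ^ n)"
        by (rule termdiff_converges[where K = 1])
           (use assms in \<open>auto intro!: sums_summable[OF sums]\<close>)
      then show ?thesis
        by (simp add: suminf_minus suminf_mult summable_mult)
    qed
    finally show ?thesis
      using assms by (simp add: field_simps)
  qed
  ultimately have D: "DERIV (\<lambda>x. \<Sum>n. c n * x ^ n) x :> - ln (1 - x) / x"
    by simp
  \<comment> \<open>The series is identified with \<open>Li2\<close> only where it converges, so the
    derivative is transferred on an open interval around \<open>x\<close>.\<close>
  show ?thesis
  proof (rule has_field_derivative_transform_within_open[OF D, of "{0<..<1}"])
  qed (use assms in \<open>auto intro!: sums_unique[OF sums, symmetric]\<close>)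
qed

lemma ln_power_int: "ln (x powi k) = of_int k * ln x" if "x > 0" for x :: real
  using that by (simp add: ln_powr flip: powr_real_of_int')

definition Rogers_L :: "real \<Rightarrow> real" where
  "Rogers_L x = Li2 x + ln x * ln (1 - x) / 2"

text \<open>The product of logarithms removes half of the \<open>Li2\<close> contribution and adds
  its mirror image, which makes the derivative invariant under x -> 1 - x.\<close>

lemma DERIV_Rogers_L:
  assumes "0 < x" "x < 1"
  shows "(Rogers_L has_real_derivative - (ln (1 - x) / x + ln x / (1 - x)) / 2) (at x)"
  unfolding Rogers_L_def
  using assms by (auto intro!: derivative_eq_intros DERIV_Li2 simp: field_simps)

lemma DERIV_Rogers_L_chain:
  assumes "(g has_real_derivative g') (at t)" "0 < g t" "g t < 1"
  shows "((\<lambda>t. Rogers_L (g t)) has_real_derivative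
    - (ln (1 - g t) / g t + ln (g t) / (1 - g t)) / 2 * g') (at t)"
  using DERIV_chain2[OF DERIV_Rogers_L assms(1)] assms(2,3) by simp

lemma tendsto_Rogers_L_0: "(Rogers_L \<longlongrightarrow> 0) (at_right 0)"
proof -
  have "(Li2 \<longlongrightarrow> Li2 0) (at 0 within {-1..1})"
    using continuous_on_Li2 unfolding continuous_on_def by (rule bspec) simp
  then have "(Li2 \<longlongrightarrow> 0) (at 0)"
    by (simp add: at_within_Icc_at)
  then have "(Li2 \<longlongrightarrow> 0) (at_right 0)"
    by (rule filterlim_mono[OF _ order_refl at_le]) simp
  moreover have "((\<lambda>x::real. ln x * ln (1 - x) / 2) \<longlongrightarrow> 0) (at_right 0)"
    by real_asymp
  ultimately show ?thesis
    unfolding Rogers_L_def by (auto intro: tendsto_eq_intros)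
qed

text \<open>This limit is the constant of the reflection formula, through which alone zeta(2) enters
  the ladder.\<close>

lemma tendsto_Rogers_L_1: "(Rogers_L \<longlongrightarrow> zeta 2) (at_left 1)"
proof -
  have "(Li2 \<longlongrightarrow> Li2 1) (at 1 within {-1..1})"
    using continuous_on_Li2 by (simp add: continuous_on_def)
  then have "(Li2 \<longlongrightarrow> zeta 2) (at_left 1)"
    by (simp add: at_within_Icc_at_left Li2_1)
  moreover have "((\<lambda>x::real. ln x * ln (1 - x) / 2) \<longlongrightarrow> 0) (at_left 1)"
    by real_asymp
  ultimately show ?thesis
    unfolding Rogers_L_def by (auto intro: tendsto_eq_intros)
qed

text \<open>Shared last step of both functional equations: a zero derivative makes \<open>f\<close>
  constant on (0,1), and the constant is read off as a limit at 0.\<close>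

lemma constant_limit_at_right_0:
  fixes f :: "real \<Rightarrow> real"
  assumes D: "\<And>t. 0 < t \<Longrightarrow> t < 1 \<Longrightarrow> (f has_real_derivative 0) (at t)"
    and lim: "(f \<longlongrightarrow> l) (at_right 0)"
    and x: "0 < x" "x < 1"
  shows "f x = l"
proof -
  have "f t = f x" if "0 < t" "t < 1" for t
  proof -
    have "\<exists>k. \<forall>u\<in>{0<..<1}. f u = k"
      using D by (intro has_field_derivative_zero_constant)
        (auto intro: has_field_derivative_at_within)
    then show ?thesis
      using that x by force
  qed
  then have "eventually (\<lambda>t. f t = f x) (at_right 0)"
    unfolding eventually_at_right_field by (intro exI[of _ 1]) auto
  then have "(f \<longlongrightarrow> f x) (at_right 0)"
    by (rule tendsto_eventually)
  then show ?thesis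
    using lim by (rule tendsto_unique[OF trivial_limit_at_right_real])
qed

section \<open>Functional equations of the Rogers dilogarithm\<close>

lemma Rogers_L_reflect:
  assumes "0 < x" "x < 1"
  shows "Rogers_L x + Rogers_L (1 - x) = zeta 2"
proof (rule constant_limit_at_right_0[OF _ _ assms])
  show "((\<lambda>t. Rogers_L t + Rogers_L (1 - t)) has_real_derivative 0) (at t)"
    if "0 < t" "t < 1" for t
    using that
    by (auto intro!: derivative_eq_intros DERIV_Rogers_L DERIV_Rogers_L_chain simp: field_simps)
  have "filterlim (\<lambda>t::real. 1 - t) (at_left 1) (at_right 0)"
    by real_asymp
  then show "((\<lambda>t. Rogers_L t + Rogers_L (1 - t)) \<longlongrightarrow> zeta 2) (at_right 0)"
    using tendsto_add[OF tendsto_Rogers_L_0 filterlim_compose[OF tendsto_Rogers_L_1]]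
    by simp
qed

lemma Rogers_L_five_term:
  assumes x: "0 < x" "x < 1" and y: "0 < y" "y < 1"
  shows "Rogers_L x + Rogers_L y =
    Rogers_L (x * y) + Rogers_L (x * (1 - y) / (1 - x * y)) + Rogers_L (y * (1 - x) / (1 - x * y))"
proof -
  \<comment> \<open>With \<open>y\<close> fixed, the relation is treated as a function of its first
    argument; \<open>f\<close> collects the terms that depend on it.\<close>
  define u where "u t = t * (1 - y) / (1 - t * y)" for t
  define v where "v t = y * (1 - t) / (1 - t * y)" for t
  define f where "f t = Rogers_L t - Rogers_L (t * y) - Rogers_L (u t) - Rogers_L (v t)" for t
  have "f x = - Rogers_L y"
  proof (rule constant_limit_at_right_0[OF _ _ x])
    show "(f has_real_derivative 0) (at t)" if t: "0 < t" "t < 1" for t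
    proof -
      have ty: "0 < t * y" "t * y < 1"
        using t y mult_strict_mono[of t 1 y 1] by simp_all
      \<comment> \<open>The complements factor like the arguments themselves, so every logarithm in
        the derivative reduces to those of t, y, 1 - y, 1 - t and 1 - t y.\<close>
      have u1: "1 - u t = (1 - t) / (1 - t * y)" and v1: "1 - v t = (1 - y) / (1 - t * y)"
        using ty by (simp_all add: u_def v_def field_simps)
      have u: "0 < u t" and v: "0 < v t" and "0 < 1 - u t" "0 < 1 - v t"
        unfolding u1 v1 unfolding u_def v_def using t y ty by simp_all
      then have u': "u t < 1" and v': "v t < 1"
        by simp_all
      have du: "(u has_real_derivative (1 - y) / (1 - t * y)\<^sup>2) (at t)"
        unfolding u_def using ty
        by (auto intro!: derivative_eq_intros simp: field_simps power2_eq_square)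
      have dv: "(v has_real_derivative - y * (1 - y) / (1 - t * y)\<^sup>2) (at t)"
        unfolding v_def using ty
        by (auto intro!: derivative_eq_intros simp: field_simps power2_eq_square)
      define A B where "A = 1 - t" and "B = 1 - t * y"
      have pos: "A > 0" "B > 0" "1 - y > 0"
        using t ty y by (simp_all add: A_def B_def)
      have logs: "ln (u t) = ln t + ln (1 - y) - ln B" "ln (1 - u t) = ln A - ln B"
          "ln (v t) = ln y + ln A - ln B" "ln (1 - v t) = ln (1 - y) - ln B"
          "ln (t * y) = ln t + ln y"
        unfolding u1 v1 unfolding u_def v_def A_def[symmetric] B_def[symmetric]
        using pos t y by (simp_all add: ln_mult ln_div)
      define D where "D s = - (ln (1 - s) / s + ln s / (1 - s)) / 2" for s :: real
      have chain: "((\<lambda>t. Rogers_L (g t)) has_real_derivative D (g t) * g') (at t)"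
        if "(g has_real_derivative g') (at t)" "0 < g t" "g t < 1" for g g'
        using DERIV_Rogers_L_chain[OF that] by (simp add: D_def)
      have "(f has_real_derivative D t - D (t * y) * y - D (u t) * ((1 - y) / B\<^sup>2)
          - D (v t) * (- y * (1 - y) / B\<^sup>2)) (at t)"
        unfolding f_def B_def
        by (rule derivative_eq_intros chain[of "\<lambda>t. t", simplified] chain du dv
              t ty u u' v v' refl)+ simp
      moreover have "D t = - (ln A / t + ln t / A) / 2"
        by (simp add: D_def A_def)
      moreover have "D (t * y) * y = - (ln B / t + (ln t + ln y) * y / B) / 2"
        unfolding D_def logs B_def[symmetric] using t y by (simp add: field_simps)
      moreover have "D (u t) * ((1 - y) / B\<^sup>2)
          = - ((ln A - ln B) / t + (ln t + ln (1 - y) - ln B) * (1 - y) / A) / (2 * B)"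
        unfolding D_def logs unfolding u1 unfolding u_def A_def[symmetric] B_def[symmetric]
        using pos t by (simp add: divide_simps power2_eq_square) (simp add: algebra_simps)
      moreover have "D (v t) * (- y * (1 - y) / B\<^sup>2)
          = ((ln (1 - y) - ln B) * (1 - y) / A + (ln y + ln A - ln B) * y) / (2 * B)"
        unfolding D_def logs unfolding v1 unfolding v_def A_def[symmetric] B_def[symmetric]
        using pos y by (simp add: divide_simps power2_eq_square) (simp add: algebra_simps)
      \<comment> \<open>The coefficient of each of the five logarithms is a rational function that
        vanishes identically once \<open>A\<close> and \<open>B\<close> are expanded.\<close>
      moreover have "- (ln A / t + ln t / A) / 2
          - - (ln B / t + (ln t + ln y) * y / B) / 2
          - - ((ln A - ln B) / t + (ln t + ln (1 - y) - ln B) * (1 - y) / A) / (2 * B)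
          - ((ln (1 - y) - ln B) * (1 - y) / A + (ln y + ln A - ln B) * y) / (2 * B) = 0"
        using pos t
        by (simp add: divide_simps) (simp add: A_def B_def algebra_simps)
      ultimately show ?thesis
        by (simp only:)
    qed
    \<comment> \<open>As t tends to 0, the arguments t, t y and \<open>u t\<close> approach 0 from
      the right and contribute nothing, while \<open>v t\<close> tends to \<open>y\<close>.\<close>
    have lim_u: "filterlim u (at_right 0) (at_right 0)"
      unfolding u_def using y by real_asymp
    have lim_ty: "filterlim (\<lambda>t. t * y) (at_right 0) (at_right 0)"
      using y by real_asymp
    have lim_v: "(v \<longlongrightarrow> y) (at_right 0)"
      unfolding v_def by (auto intro!: tendsto_eq_intros)
    have "isCont Rogers_L y"
      using DERIV_Rogers_L[OF y] by (rule DERIV_isCont)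
    then show "(f \<longlongrightarrow> - Rogers_L y) (at_right 0)"
      unfolding f_def
      using tendsto_Rogers_L_0 filterlim_compose[OF tendsto_Rogers_L_0 lim_u]
        filterlim_compose[OF tendsto_Rogers_L_0 lim_ty] isCont_tendsto_compose[OF _ lim_v]
      by (auto intro!: tendsto_eq_intros)
  qed
  then show ?thesis
    by (simp add: f_def u_def v_def)
qed

subsection \<open>Exceptional S-units at the base of the ladder\<close>

text \<open>Exponent vectors turn products and quotients of arguments into sums and differences of
  integer tuples, so the side conditions of each relation are settled by plain computation.\<close>

type_synonym expt = "int \<times> int \<times> int \<times> int \<times> int \<times> int"

locale ladder_base =
  fixes h :: real
  assumes h_pos: "0 < h" and h_less_1: "h < 1"
    and root: "h^6 - 3 * h^5 + 5 * h^4 - 8 * h^3 + 5 * h^2 - 3 * h + 1 = 0"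
begin

text \<open>The polynomial is palindromic: in terms of \<open>y = h + 1 / h > 2\<close> it becomes
  \<open>y (y - 1) (y - 2) = 2\<close>, whose left-hand side is increasing.\<close>

lemma trace_gt_2: "h + 1 / h > 2"
proof -
  have "h + 1 / h - 2 = (1 - h)\<^sup>2 / h"
    using h_pos by (simp add: field_simps power2_eq_square)
  also have "\<dots> > 0"
    using h_pos h_less_1 by simp
  finally show ?thesis
    by simp
qed

lemma trace_eq: "(h + 1 / h) * (h + 1 / h - 1) * (h + 1 / h - 2) = 2"
proof -
  have "(h\<^sup>2 + 1) * (h\<^sup>2 + 1 - h) * (h\<^sup>2 + 1 - 2 * h) = 2 * h ^ 3"
    using root by algebra
  then have "(h\<^sup>2 + 1) / h * ((h\<^sup>2 + 1 - h) / h) * ((h\<^sup>2 + 1 - 2 * h) / h) = 2"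
    using h_pos by (simp add: power3_eq_cube)
  moreover have "(h\<^sup>2 + 1) / h = h + 1 / h" "(h\<^sup>2 + 1 - h) / h = h + 1 / h - 1"
      "(h\<^sup>2 + 1 - 2 * h) / h = h + 1 / h - 2"
    using h_pos by (simp_all add: field_simps power2_eq_square)
  ultimately show ?thesis
    by simp
qed

text \<open>Makes the factor 1 - 2h positive, hence all monomials. For h >= 1/2 one has y = h + 1/h
  <= 5/2, so y (y - 1) (y - 2) would be at most 15/8 < 2.\<close>

lemma h_less_half: "2 * h < 1"
proof (rule ccontr)
  assume "\<not> 2 * h < 1"
  then have "(2 * h - 1) * (2 - h) \<ge> 0"
    using h_less_1 by simp
  then have "h + 1 / h \<le> 5 / 2"
    using h_pos by (simp add: field_simps)
  then have "(h + 1 / h) * (h + 1 / h - 1) * (h + 1 / h - 2) \<le> 5 / 2 * (3 / 2) * (1 / 2)"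
    using trace_gt_2 by (intro mult_mono) auto
  then show False
    unfolding trace_eq by simp
qed

section \<open>Monomials and complementary pairs\<close>

definition mon :: "expt \<Rightarrow> real" where
  "mon = (\<lambda>(i, j, k, l, m, n). h powi i * (1 - h) powi j * (1 + h) powi k *
    (1 + h\<^sup>2) powi l * (1 - h + h\<^sup>2) powi m * (1 - 2 * h) powi n)"

text \<open>Certifies an exceptional argument. Since monomials are positive, both members of such a
  pair automatically lie in (0,1).\<close>

definition compl :: "expt \<Rightarrow> expt \<Rightarrow> bool" where
  "compl v w \<longleftrightarrow> mon v + mon w = 1"

abbreviation L :: "expt \<Rightarrow> real" where
  "L v \<equiv> Rogers_L (mon v)"

lemma factors_pos: "0 < 1 - h" "0 < 1 + h" "0 < 1 + h\<^sup>2" "0 < 1 - h + h\<^sup>2" "0 < 1 - 2 * h"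
  using h_pos h_less_1 h_less_half by (auto intro: add_pos_nonneg)

lemma mon_pos: "mon v > 0"
  using h_pos factors_pos by (simp add: mon_def split: prod.split)

lemma mon_add: "mon (v + w) = mon v * mon w"
  using h_pos factors_pos
  by (cases v; cases w) (simp add: mon_def power_int_add less_imp_neq[symmetric])

lemma mon_diff: "mon (v - w) = mon v / mon w"
proof -
  have "mon v = mon (v - w) * mon w"
    by (simp flip: mon_add)
  then show ?thesis
    using mon_pos[of w] by simp
qed

lemma ln_mon: "ln (mon (i, j, k, l, m, n)) = of_int i * ln h + of_int j * ln (1 - h)
    + of_int k * ln (1 + h) + of_int l * ln (1 + h\<^sup>2) + of_int m * ln (1 - h + h\<^sup>2)
    + of_int n * ln (1 - 2 * h)"
  using h_pos factors_pos by (simp add: mon_def ln_mult ln_power_int less_imp_neq[symmetric])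

lemma compl_sym: "compl v w \<Longrightarrow> compl w v"
  by (simp add: compl_def add.commute)

text \<open>The vector \<open>d\<close> is a common denominator: it clears the negative exponents
  and leaves a polynomial identity.\<close>

lemma compl_I: "mon (v + d) + mon (w + d) = mon d \<Longrightarrow> compl v w"
  using mon_pos[of d] by (simp add: compl_def mon_add flip: distrib_right)

text \<open>Rests on x (1 - y) + (1 - x) = 1 - x y. Thus if x, y and x y are exceptional, the
  quotient argument of the five-term relation is exceptional too, and its complement is known
  explicitly.\<close>

lemma compl_u:
  assumes "compl x x'" "compl y y'" "compl p q" "p = x + y" "u = x + y' - q" "u' = x' - q"
  shows "compl u u'"
proof -
  have "mon x * mon y' + mon x' = mon q"
    using assms(1-3) unfolding compl_def assms(4) mon_add by algebra
  then show ?thesis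
    using mon_pos[of q] by (simp add: compl_def assms mon_add mon_diff flip: add_divide_distrib)
qed

lemma compl_v:
  assumes "compl x x'" "compl y y'" "compl p q" "p = x + y" "v = y + x' - q" "v' = y' - q"
  shows "compl v v'"
  using compl_u[OF assms(2,1,3)] assms(4-) by (simp add: add.commute)

lemma L_five_term:
  assumes "compl x x'" "compl y y'" "compl p q" "p = x + y" "u = x + y' - q" "v = y + x' - q"
  shows "L x + L y = L p + L u + L v"
proof -
  have "mon x' = 1 - mon x" "mon y' = 1 - mon y" "mon q = 1 - mon x * mon y"
    using assms(1-4) by (simp_all add: compl_def mon_add)
  moreover from this have "mon x < 1" "mon y < 1"
    using mon_pos[of x'] mon_pos[of y'] by simp_all
  ultimately show ?thesis
    using Rogers_L_five_term[of "mon x" "mon y"] mon_pos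
    by (simp add: assms(4-) mon_add mon_diff)
qed

lemma L_reflect:
  assumes "compl x x'"
  shows "L x + L x' = zeta 2"
proof -
  have "mon x' = 1 - mon x"
    using assms by (simp add: compl_def)
  moreover from this have "mon x < 1"
    using mon_pos[of x'] by simp
  ultimately show ?thesis
    using Rogers_L_reflect mon_pos by simp
qed

text \<open>The complement \<open>v\<close> factors 1 - h^k over the base, which lets
  \<open>ln_mon\<close> expand the elementary correction term.\<close>

lemma Li2_power:
  assumes "compl (int k, 0, 0, 0, 0, 0) v"
  shows "Li2 (h ^ k) = L (int k, 0, 0, 0, 0, 0) - real k * ln h * ln (mon v) / 2"
proof -
  have "mon (int k, 0, 0, 0, 0, 0) = h ^ k"
    by (simp add: mon_def)
  moreover from this have "1 - h ^ k = mon v"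
    using assms by (simp add: compl_def)
  ultimately show ?thesis
    using h_pos by (simp add: Rogers_L_def ln_realpow)
qed

text \<open>Eighteen complementary pairs are polynomial identities in \<open>h\<close>, the first seven of them
  unconditional. All others occur as arguments on the right of a five-term relation between pairs
  already known.\<close>

lemma compl_1: "compl (3, 0, -1, 0, -1, 0) (0, 0, -1, 0, -1, 0)"
  by (rule compl_I[of _ "(0, 0, 1, 0, 1, 0)"]) (simp add: mon_def, algebra?)

lemma compl_2: "compl (1, 0, 0, 0, -1, 0) (0, 2, 0, 0, -1, 0)"
  by (rule compl_I[of _ "(0, 0, 0, 0, 1, 0)"]) (simp add: mon_def, algebra?)

lemma compl_3: "compl (2, 0, 0, 0, 0, 0) (0, 1, 1, 0, 0, 0)"
  by (rule compl_I[of _ "(0, 0, 0, 0, 0, 0)"]) (simp add: mon_def, algebra?)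

lemma compl_4: "compl (1, 0, 0, 0, 1, 0) (0, 1, 0, 1, 0, 0)"
  by (rule compl_I[of _ "(0, 0, 0, 0, 0, 0)"]) (simp add: mon_def, algebra?)

lemma compl_5: "compl (1, 0, 0, 0, 0, 0) (0, 1, 0, 0, 0, 0)"
  by (rule compl_I[of _ "(0, 0, 0, 0, 0, 0)"]) (simp add: mon_def, algebra?)

lemma compl_6: "compl (1, -1, 0, 0, 0, 0) (0, -1, 0, 0, 0, 1)"
  by (rule compl_I[of _ "(0, 1, 0, 0, 0, 0)"]) (simp add: mon_def, algebra?)

lemma compl_7: "compl (1, 1, 0, 0, 0, 0) (0, 0, 0, 0, 1, 0)"
  by (rule compl_I[of _ "(0, 0, 0, 0, 0, 0)"]) (simp add: mon_def, algebra?)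

lemma compl_8: "compl (1, 2, 0, -1, -1, 0) (-1, 2, 0, 1, -1, 0)"
  by (rule compl_I[of _ "(1, 0, 0, 1, 1, 0)"]) (use root in \<open>simp add: mon_def, algebra\<close>)

lemma compl_9: "compl (0, 0, 0, 1, 1, 0) (0, -2, 0, 1, 0, 1)"
  by (rule compl_I[of _ "(0, 2, 0, 0, 0, 0)"]) (use root in \<open>simp add: mon_def, algebra\<close>)

lemma compl_10: "compl (5, 1, 0, -1, 0, -1) (1, 1, 0, -1, 1, 0)"
  by (rule compl_I[of _ "(0, 0, 0, 1, 0, 1)"]) (use root in \<open>simp add: mon_def, algebra\<close>)

lemma compl_11: "compl (0, 2, 0, -1, 0, 0) (-2, 2, 0, 0, 1, 0)"
  by (rule compl_I[of _ "(2, 0, 0, 1, 0, 0)"]) (use root in \<open>simp add: mon_def, algebra\<close>)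

lemma compl_12: "compl (1, -1, 0, 0, 1, 0) (-1, -3, 0, 1, 0, 1)"
  by (rule compl_I[of _ "(1, 3, 0, 0, 0, 0)"]) (use root in \<open>simp add: mon_def, algebra\<close>)

lemma compl_13: "compl (3, -2, 0, 0, 0, 0) (-1, -4, 0, 1, 0, 1)"
  by (rule compl_I[of _ "(1, 4, 0, 0, 0, 0)"]) (use root in \<open>simp add: mon_def, algebra\<close>)

lemma compl_14: "compl (4, 2, 0, -1, 0, -1) (1, 2, 0, 0, 0, 0)"
  by (rule compl_I[of _ "(0, 0, 0, 1, 0, 1)"]) (use root in \<open>simp add: mon_def, algebra\<close>)

lemma compl_15: "compl (-1, 2, 0, 0, 0, 0) (-2, 2, 0, -1, 2, 0)"
  by (rule compl_I[of _ "(2, 0, 0, 1, 0, 0)"]) (use root in \<open>simp add: mon_def, algebra\<close>)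

lemma compl_16: "compl (3, 0, 0, 0, -3, 0) (2, 0, 0, 1, -3, 0)"
  by (rule compl_I[of _ "(0, 0, 0, 0, 3, 0)"]) (use root in \<open>simp add: mon_def, algebra\<close>)

lemma compl_17: "compl (3, 0, 0, 0, 0, 0) (-2, 1, 0, 0, 3, 0)"
  by (rule compl_I[of _ "(2, 0, 0, 0, 0, 0)"]) (use root in \<open>simp add: mon_def, algebra\<close>)

lemma compl_18: "compl (5, 2, 0, -1, -1, 0) (1, 6, 0, 1, -1, -1)"
  by (rule compl_I[of _ "(0, 0, 0, 1, 1, 1)"]) (use root in \<open>simp add: mon_def, algebra\<close>)

section \<open>Five-term relations and the complements derived from them\<close>

lemma five_term_1:
  "L (3, 0, 0, 0, 0, 0) + L (0, 0, -1, 0, -1, 0) =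
    L (3, 0, -1, 0, -1, 0) + L (6, 0, 0, 0, 0, 0) + L (-2, 1, 0, 0, 3, 0)"
  \<comment> \<open>For the pair z, 1/(1 + z) the two quotient arguments are z^2 and 1 - z; here z =
    h^3, which brings in h^6.\<close>
  by (rule L_five_term[OF compl_17 compl_1[THEN compl_sym] compl_1])
    (simp_all add: zero_prod_def)

lemma compl_19: "compl (6, 0, 0, 0, 0, 0) (-2, 1, 1, 0, 4, 0)"
  by (rule compl_u[OF compl_17 compl_1[THEN compl_sym] compl_1])
    (simp_all add: zero_prod_def)

lemma five_term_2:
  "L (4, 2, 0, -1, 0, -1) + L (1, -1, 0, 0, 0, 0) =
    L (5, 1, 0, -1, 0, -1) + L (3, 0, 0, 0, -1, 0) + L (1, 0, 0, 1, -1, 0)"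
  by (rule L_five_term[OF compl_14 compl_6 compl_10])
    (simp_all add: zero_prod_def)

lemma compl_20: "compl (3, 0, 0, 0, -1, 0) (0, 1, 0, 1, -1, 0)"
  by (rule compl_u[OF compl_14 compl_6 compl_10])
    (simp_all add: zero_prod_def)

lemma compl_21: "compl (1, 0, 0, 1, -1, 0) (-1, -2, 0, 1, -1, 1)"
  by (rule compl_v[OF compl_14 compl_6 compl_10])
    (simp_all add: zero_prod_def)

lemma five_term_3:
  "L (1, 0, 0, 0, 1, 0) + L (0, 2, 0, 0, -1, 0) =
    L (1, 2, 0, 0, 0, 0) + L (-2, -2, 0, 1, 0, 1) + L (-4, 1, 0, 2, -1, 1)"
  by (rule L_five_term[OF compl_4 compl_2[THEN compl_sym] compl_14[THEN compl_sym]])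
    (simp_all add: zero_prod_def)

lemma compl_22: "compl (-2, -2, 0, 1, 0, 1) (-4, -1, 0, 2, 0, 1)"
  by (rule compl_u[OF compl_4 compl_2[THEN compl_sym] compl_14[THEN compl_sym]])
    (simp_all add: zero_prod_def)

lemma compl_23: "compl (-4, 1, 0, 2, -1, 1) (-3, -2, 0, 1, -1, 1)"
  by (rule compl_v[OF compl_4 compl_2[THEN compl_sym] compl_14[THEN compl_sym]])
    (simp_all add: zero_prod_def)

text \<open>Abel's duplication formula, the diagonal case x = y.\<close>

lemma five_term_4:
  "L (1, 0, 0, 0, 0, 0) + L (1, 0, 0, 0, 0, 0) =
    L (2, 0, 0, 0, 0, 0) + L (1, 0, -1, 0, 0, 0) + L (1, 0, -1, 0, 0, 0)"
  by (rule L_five_term[OF compl_5 compl_5 compl_3])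
    (simp_all add: zero_prod_def)

lemma compl_24: "compl (1, 0, -1, 0, 0, 0) (0, 0, -1, 0, 0, 0)"
  by (rule compl_u[OF compl_5 compl_5 compl_3])
    (simp_all add: zero_prod_def)

lemma five_term_5:
  "L (1, 0, 0, 0, 1, 0) + L (0, 0, -1, 0, -1, 0) =
    L (1, 0, -1, 0, 0, 0) + L (4, 0, 0, 0, 0, 0) + L (0, 1, 0, 1, -1, 0)"
  by (rule L_five_term[OF compl_4 compl_1[THEN compl_sym] compl_24])
    (simp_all add: zero_prod_def)

lemma compl_25: "compl (4, 0, 0, 0, 0, 0) (0, 1, 1, 1, 0, 0)"
  by (rule compl_u[OF compl_4 compl_1[THEN compl_sym] compl_24])
    (simp_all add: zero_prod_def)

lemma five_term_6:
  "L (3, -2, 0, 0, 0, 0) + L (1, 2, 0, 0, 0, 0) =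
    L (4, 0, 0, 0, 0, 0) + L (7, -1, -1, -2, 0, -1) + L (0, -3, -1, 0, 0, 1)"
  by (rule L_five_term[OF compl_13 compl_14[THEN compl_sym] compl_25])
    (simp_all add: zero_prod_def)

lemma compl_26: "compl (7, -1, -1, -2, 0, -1) (-1, -5, -1, 0, 0, 1)"
  by (rule compl_u[OF compl_13 compl_14[THEN compl_sym] compl_25])
    (simp_all add: zero_prod_def)

lemma compl_27: "compl (0, -3, -1, 0, 0, 1) (4, 1, -1, -2, 0, -1)"
  by (rule compl_v[OF compl_13 compl_14[THEN compl_sym] compl_25])
    (simp_all add: zero_prod_def)

lemma five_term_7:
  "L (0, -3, -1, 0, 0, 1) + L (0, 1, 1, 1, 0, 0) =
    L (0, -2, 0, 1, 0, 1) + L (4, -3, -1, -1, -1, 1) + L (4, 2, 0, -2, -1, -1)"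
  by (rule L_five_term[OF compl_27 compl_25[THEN compl_sym] compl_9[THEN compl_sym]])
    (simp_all add: zero_prod_def)

lemma compl_28: "compl (4, -3, -1, -1, -1, 1) (4, 1, -1, -3, -1, -1)"
  by (rule compl_u[OF compl_27 compl_25[THEN compl_sym] compl_9[THEN compl_sym]])
    (simp_all add: zero_prod_def)

lemma compl_29: "compl (4, 2, 0, -2, -1, -1) (4, 0, 0, -1, -1, 0)"
  by (rule compl_v[OF compl_27 compl_25[THEN compl_sym] compl_9[THEN compl_sym]])
    (simp_all add: zero_prod_def)

lemma five_term_8:
  "L (-1, -5, -1, 0, 0, 1) + L (5, 2, 0, -1, -1, 0) =
    L (4, -3, -1, -1, -1, 1) + L (-4, 0, 0, 4, 0, 1) + L (8, 0, 0, 0, 0, 0)"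
  by (rule L_five_term[OF compl_26[THEN compl_sym] compl_18 compl_28])
    (simp_all add: zero_prod_def)

lemma compl_30: "compl (-4, 0, 0, 4, 0, 1) (3, -2, 0, 1, 1, 0)"
  by (rule compl_u[OF compl_26[THEN compl_sym] compl_18 compl_28])
    (simp_all add: zero_prod_def)

text \<open>Together with \<open>compl_25\<close> this amounts to 1 + h^4 = (1 - h)^4 (1 + h^2)^3 /
  h^3, which is special to this root.\<close>

lemma compl_31: "compl (8, 0, 0, 0, 0, 0) (-3, 5, 1, 4, 0, 0)"
  by (rule compl_v[OF compl_26[THEN compl_sym] compl_18 compl_28])
    (simp_all add: zero_prod_def)

lemma five_term_9:
  "L (4, 0, 0, -1, -1, 0) + L (1, 2, 0, 0, 0, 0) =
    L (5, 2, 0, -1, -1, 0) + L (7, -4, 0, -3, 0, 0) + L (4, -2, 0, -3, 0, 0)"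
  by (rule L_five_term[OF compl_29[THEN compl_sym] compl_14[THEN compl_sym] compl_18])
    (simp_all add: zero_prod_def)

lemma compl_32: "compl (7, -4, 0, -3, 0, 0) (3, -4, 0, -3, 0, 0)"
  by (rule compl_u[OF compl_29[THEN compl_sym] compl_14[THEN compl_sym] compl_18])
    (simp_all add: zero_prod_def)

lemma compl_33: "compl (4, -2, 0, -3, 0, 0) (3, -4, 0, -2, 1, 0)"
  by (rule compl_v[OF compl_29[THEN compl_sym] compl_14[THEN compl_sym] compl_18])
    (simp_all add: zero_prod_def)

text \<open>Up to complements, all arguments on the right already occur in
  \<open>five_term_8\<close> and \<open>five_term_9\<close>, so the relation helps to eliminate
  them.\<close>

lemma five_term_10:
  "L (3, -2, 0, 0, 0, 0) + L (0, 0, 0, 1, 1, 0) =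
    L (3, -2, 0, 1, 1, 0) + L (7, -4, 0, -3, 0, 0) + L (3, -4, 0, -2, 1, 0)"
  by (rule L_five_term[OF compl_13 compl_9 compl_30[THEN compl_sym]])
    (simp_all add: zero_prod_def)

lemma five_term_11:
  "L (3, 0, 0, 0, -1, 0) + L (-2, 2, 0, 0, 1, 0) =
    L (1, 2, 0, 0, 0, 0) + L (-1, 0, 0, 0, -1, 1) + L (-6, 1, 0, 2, 0, 1)"
  by (rule L_five_term[OF compl_20 compl_11[THEN compl_sym] compl_14[THEN compl_sym]])
    (simp_all add: zero_prod_def)

lemma compl_34: "compl (-1, 0, 0, 0, -1, 1) (-4, -1, 0, 2, -1, 1)"
  by (rule compl_u[OF compl_20 compl_11[THEN compl_sym] compl_14[THEN compl_sym]])
    (simp_all add: zero_prod_def)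

lemma compl_35: "compl (-6, 1, 0, 2, 0, 1) (-4, 0, 0, 0, 0, 1)"
  by (rule compl_v[OF compl_20 compl_11[THEN compl_sym] compl_14[THEN compl_sym]])
    (simp_all add: zero_prod_def)

lemma five_term_12:
  "L (0, 0, 0, 0, 1, 0) + L (1, 0, 0, 0, 0, 0) =
    L (1, 0, 0, 0, 1, 0) + L (0, 0, 0, -1, 1, 0) + L (2, 0, 0, -1, 0, 0)"
  by (rule L_five_term[OF compl_7[THEN compl_sym] compl_5 compl_4])
    (simp_all add: zero_prod_def)

lemma compl_36: "compl (0, 0, 0, -1, 1, 0) (1, 0, 0, -1, 0, 0)"
  by (rule compl_u[OF compl_7[THEN compl_sym] compl_5 compl_4])
    (simp_all add: zero_prod_def)

lemma compl_37: "compl (2, 0, 0, -1, 0, 0) (0, 0, 0, -1, 0, 0)"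
  by (rule compl_v[OF compl_7[THEN compl_sym] compl_5 compl_4])
    (simp_all add: zero_prod_def)

lemma five_term_13:
  "L (1, 0, 0, 1, -1, 0) + L (2, 0, 0, -1, 0, 0) =
    L (3, 0, 0, 0, -1, 0) + L (1, -1, 0, -1, 0, 0) + L (1, -3, 0, -1, 0, 1)"
  by (rule L_five_term[OF compl_21 compl_37 compl_20])
    (simp_all add: zero_prod_def)

lemma compl_38: "compl (1, -1, 0, -1, 0, 0) (-1, -3, 0, 0, 0, 1)"
  by (rule compl_u[OF compl_21 compl_37 compl_20])
    (simp_all add: zero_prod_def)

lemma five_term_14:
  "L (0, 2, 0, -1, 0, 0) + L (1, 0, 0, 0, -1, 0) =
    L (1, 2, 0, -1, -1, 0) + L (1, 2, 0, -2, 0, 0) + L (0, 0, 0, -1, 1, 0)"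
  by (rule L_five_term[OF compl_11 compl_2 compl_8])
    (simp_all add: zero_prod_def)

text \<open>The second quotient argument equals the first argument, so one term cancels and a
  three-term relation remains.\<close>

lemma five_term_15:
  "L (1, 0, 0, -1, 0, 0) + L (-1, 2, 0, 0, 0, 0) =
    L (0, 2, 0, -1, 0, 0) + L (1, 0, 0, -2, 1, 0) + L (1, 0, 0, -1, 0, 0)"
  by (rule L_five_term[OF compl_36[THEN compl_sym] compl_15 compl_11])
    (simp_all add: zero_prod_def)

lemma compl_39: "compl (1, 0, 0, -2, 1, 0) (2, -2, 0, -1, 0, 0)"
  by (rule compl_u[OF compl_36[THEN compl_sym] compl_15 compl_11])
    (simp_all add: zero_prod_def)

lemma five_term_16:
  "L (1, 1, 0, 0, 0, 0) + L (0, 1, 0, 0, 0, 0) =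
    L (1, 2, 0, 0, 0, 0) + L (-2, -1, 0, 1, 0, 1) + L (-4, -1, 0, 1, 1, 1)"
  by (rule L_five_term[OF compl_7 compl_5[THEN compl_sym] compl_14[THEN compl_sym]])
    (simp_all add: zero_prod_def)

lemma compl_40: "compl (-2, -1, 0, 1, 0, 1) (-4, -2, 0, 1, 1, 1)"
  by (rule compl_u[OF compl_7 compl_5[THEN compl_sym] compl_14[THEN compl_sym]])
    (simp_all add: zero_prod_def)

lemma compl_41: "compl (-4, -1, 0, 1, 1, 1) (-3, -2, 0, 1, 0, 1)"
  by (rule compl_v[OF compl_7 compl_5[THEN compl_sym] compl_14[THEN compl_sym]])
    (simp_all add: zero_prod_def)

lemma five_term_17:
  "L (1, -1, 0, 0, 1, 0) + L (0, 1, 0, 0, 0, 0) =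
    L (1, 0, 0, 0, 1, 0) + L (2, -2, 0, -1, 1, 0) + L (-1, -3, 0, 0, 0, 1)"
  by (rule L_five_term[OF compl_12 compl_5[THEN compl_sym] compl_4])
    (simp_all add: zero_prod_def)

lemma compl_42: "compl (2, -2, 0, -1, 1, 0) (-1, -4, 0, 0, 0, 1)"
  by (rule compl_u[OF compl_12 compl_5[THEN compl_sym] compl_4])
    (simp_all add: zero_prod_def)

lemma five_term_18:
  "L (3, 0, 0, 0, -3, 0) + L (-2, 2, 0, -1, 2, 0) =
    L (1, 2, 0, -1, -1, 0) + L (3, 0, 0, -1, -2, 0) + L (1, 0, 0, -1, 0, 0)"
  by (rule L_five_term[OF compl_16 compl_15[THEN compl_sym] compl_8])
    (simp_all add: zero_prod_def)

lemma compl_43: "compl (3, 0, 0, -1, -2, 0) (3, -2, 0, 0, -2, 0)"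
  by (rule compl_u[OF compl_16 compl_15[THEN compl_sym] compl_8])
    (simp_all add: zero_prod_def)

lemma five_term_19:
  "L (3, 0, 0, -1, -2, 0) + L (-2, 1, 0, 0, 3, 0) =
    L (1, 1, 0, -1, 1, 0) + L (1, -1, 0, 0, -2, 1) + L (-4, -2, 0, 1, 1, 1)"
  by (rule L_five_term[OF compl_43 compl_17[THEN compl_sym] compl_10[THEN compl_sym]])
    (simp_all add: zero_prod_def)

lemma compl_44: "compl (1, -1, 0, 0, -2, 1) (-2, -3, 0, 1, -2, 1)"
  by (rule compl_u[OF compl_43 compl_17[THEN compl_sym] compl_10[THEN compl_sym]])
    (simp_all add: zero_prod_def)

lemma five_term_20:
  "L (3, -2, 0, 0, -2, 0) + L (0, 2, 0, 0, -1, 0) =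
    L (3, 0, 0, 0, -3, 0) + L (2, -2, 0, -1, 0, 0) + L (1, 2, 0, -2, 0, 0)"
  by (rule L_five_term[OF compl_43[THEN compl_sym] compl_2[THEN compl_sym] compl_16])
    (simp_all add: zero_prod_def)

lemma five_term_21:
  "L (-2, -2, 0, 1, 0, 1) + L (1, -1, 0, 0, 0, 0) =
    L (-1, -3, 0, 1, 0, 1) + L (-3, -2, 0, 1, -1, 2) + L (-4, -1, 0, 2, -1, 1)"
  by (rule L_five_term[OF compl_22 compl_6 compl_12[THEN compl_sym]])
    (simp_all add: zero_prod_def)

lemma compl_45: "compl (-3, -2, 0, 1, -1, 2) (-5, 0, 0, 2, -1, 1)"
  by (rule compl_u[OF compl_22 compl_6 compl_12[THEN compl_sym]])
    (simp_all add: zero_prod_def)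

lemma five_term_22:
  "L (1, -1, 0, 0, -2, 1) + L (-4, -1, 0, 1, 1, 1) =
    L (-3, -2, 0, 1, -1, 2) + L (3, -3, 0, -1, -1, 1) + L (-1, -4, 0, 0, 0, 1)"
  by (rule L_five_term[OF compl_44 compl_41 compl_45])
    (simp_all add: zero_prod_def)

lemma compl_46: "compl (3, -3, 0, -1, -1, 1) (3, -3, 0, -1, -1, 0)"
  by (rule compl_u[OF compl_44 compl_41 compl_45])
    (simp_all add: zero_prod_def)

lemma five_term_23:
  "L (3, -3, 0, -1, -1, 0) + L (-6, 1, 0, 2, 0, 1) =
    L (-3, -2, 0, 1, -1, 1) + L (3, -4, 0, -3, 0, 0) + L (1, -3, 0, -1, 0, 1)"
  by (rule L_five_term[OF compl_46[THEN compl_sym] compl_35 compl_23[THEN compl_sym]])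
    (simp_all add: zero_prod_def)

section \<open>Linear elimination and cancellation of logarithms\<close>

lemmas reflections =
    compl_26[THEN L_reflect] compl_30[THEN L_reflect] compl_14[THEN L_reflect]
    compl_1[THEN L_reflect] compl_17[THEN L_reflect] compl_29[THEN L_reflect]
    compl_33[THEN L_reflect] compl_46[THEN L_reflect] compl_32[THEN L_reflect]
    compl_25[THEN L_reflect] compl_9[THEN L_reflect] compl_20[THEN L_reflect]
    compl_10[THEN L_reflect] compl_40[THEN L_reflect] compl_42[THEN L_reflect]
    compl_2[THEN L_reflect] compl_23[THEN L_reflect] compl_11[THEN L_reflect]
    compl_7[THEN L_reflect] compl_36[THEN L_reflect] compl_43[THEN L_reflect]
    compl_39[THEN L_reflect] compl_5[THEN L_reflect] compl_38[THEN L_reflect]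
    compl_15[THEN L_reflect] compl_12[THEN L_reflect] compl_34[THEN L_reflect]

lemmas five_terms =
    five_term_1 five_term_2 five_term_3 five_term_4 five_term_5 five_term_6 five_term_7
    five_term_8 five_term_9 five_term_10 five_term_11 five_term_12 five_term_13 five_term_14
    five_term_15 five_term_16 five_term_17 five_term_18 five_term_19 five_term_20 five_term_21
    five_term_22 five_term_23

lemma ladder:
  "Li2 (h^8) + 3 * Li2 (h^6) - 8 * Li2 (h^4) - 8 * Li2 (h^3)
     + 3 * Li2 (h^2) - 8 * Li2 h - 6 * (ln h)^2 = - 5 * zeta 2"
proof -
  have "L (8, 0, 0, 0, 0, 0) + 3 * L (6, 0, 0, 0, 0, 0) - 8 * L (4, 0, 0, 0, 0, 0)
      - 8 * L (3, 0, 0, 0, 0, 0) + 3 * L (2, 0, 0, 0, 0, 0) - 8 * L (1, 0, 0, 0, 0, 0)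
      = - 5 * zeta 2"
    \<comment> \<open>Each \<open>L v\<close> is treated as an unknown. The claim is a linear
      consequence of the five-term relations, with the reflections identifying complementary
      unknowns.\<close>
    using five_terms reflections by argo
  then show ?thesis
    \<comment> \<open>Weighting the exponent vector of 1 - h^k by k times its coefficient in the
      ladder and summing gives (-12, 0, 0, 0, 0, 0). The factor -ln h / 2 turns this into 6 (ln
      h)^2, which the last term of the ladder cancels.\<close>
    using Li2_power[of 8, simplified, OF compl_31] Li2_power[of 6, simplified, OF compl_19]
      Li2_power[of 4, simplified, OF compl_25] Li2_power[of 3, simplified, OF compl_17]
      Li2_power[of 2, simplified, OF compl_3] Li2_power[of 1, simplified, OF compl_5]
    by (simp add: ln_mon power2_eq_square) (simp add: algebra_simps)
qed

end

section \<open>Existence and uniqueness of the root\<close>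

lemma ladder_base_le:
  assumes "ladder_base g" "ladder_base h"
  shows "h \<le> g"
proof (rule ccontr)
  interpret g: ladder_base g by fact
  interpret h: ladder_base h by fact
  assume "\<not> h \<le> g"
  \<comment> \<open>Divided by g h, this product is (g + 1/g) - (h + 1/h). A larger root would thus
    have a smaller trace, contradicting the strict growth of y (y - 1) (y - 2) for y > 2.\<close>
  then have "0 < (h - g) * (1 - g * h)"
    using g.h_pos g.h_less_1 h.h_pos h.h_less_1 mult_strict_mono[of g 1 h 1] by simp
  then have "h + 1 / h < g + 1 / g"
    using g.h_pos h.h_pos by (simp add: field_simps)
  then have "(h + 1 / h) * (h + 1 / h - 1) * (h + 1 / h - 2)
      < (g + 1 / g) * (g + 1 / g - 1) * (g + 1 / g - 2)"
    using h.trace_gt_2 by (intro mult_strict_mono) auto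
  then show False
    unfolding g.trace_eq h.trace_eq by simp
qed

theorem theorem7:
  shows "(\<exists>!h::real. 0 < h \<and> h < 1 \<and>
            h^6 - 3 * h^5 + 5 * h^4 - 8 * h^3 + 5 * h^2 - 3 * h + 1 = 0) \<and>
         (\<forall>h::real. 0 < h \<and> h < 1 \<and>
            h^6 - 3 * h^5 + 5 * h^4 - 8 * h^3 + 5 * h^2 - 3 * h + 1 = 0 \<longrightarrow>
            Li2 (h^8) + 3 * Li2 (h^6) - 8 * Li2 (h^4) - 8 * Li2 (h^3)
              + 3 * Li2 (h^2) - 8 * Li2 h - 6 * (ln h)^2 = - 5 * zeta 2)"
proof (intro conjI allI impI)
  let ?p = "\<lambda>h::real. h^6 - 3 * h^5 + 5 * h^4 - 8 * h^3 + 5 * h^2 - 3 * h + 1"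
  have "\<exists>h\<ge>0. h \<le> 1 \<and> ?p h = 0"
    \<comment> \<open>The polynomial takes the values 1 at 0 and -2 at 1, so the root found lies
      strictly inside.\<close>
    by (rule IVT2') (auto intro!: continuous_intros)
  then obtain h where h: "0 \<le> h" "h \<le> 1" "?p h = 0"
    by blast
  then have "h \<noteq> 0" "h \<noteq> 1"
    by auto
  with h have ex: "0 < h \<and> h < 1 \<and> ?p h = 0"
    by simp
  show "\<exists>!h::real. 0 < h \<and> h < 1 \<and> ?p h = 0"
  proof (rule ex1I, rule ex)
    show "g = h" if "0 < g \<and> g < 1 \<and> ?p g = 0" for g
    proof -
      have "ladder_base g" "ladder_base h"
        using that ex by (simp_all add: ladder_base_def)
      then show ?thesis
        by (intro order.antisym ladder_base_le)
    qed
  qed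
next
  fix h :: real
  assume "0 < h \<and> h < 1 \<and> h^6 - 3 * h^5 + 5 * h^4 - 8 * h^3 + 5 * h^2 - 3 * h + 1 = 0"
  then interpret ladder_base h
    by unfold_locales simp_all
  show "Li2 (h^8) + 3 * Li2 (h^6) - 8 * Li2 (h^4) - 8 * Li2 (h^3)
      + 3 * Li2 (h^2) - 8 * Li2 h - 6 * (ln h)^2 = - 5 * zeta 2"
    by (rule ladder)
qed

end
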